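(* Let $X: I\to Q^2_+$ be a spacelike curve parametrized by arc length $s$ whose curvature $k(s)$ does not vanish, and let $\hat X(s,t)=f(t)X(s)$, $(s,t)\in I\times J$, $f(t)>0$, $f(0)=1$, be an evolution of $X$ by homotheties. The family $\hat X(s,t)$ satisfies the inverse curvature flow (ICF) if and only if the curvature $k$ of $X$ is constant, $f(t)=1/\sqrt{\frac{2t}{k}+1}$ and $\hat k(s,t)=2t+k$, where $\hat k(\cdot,t)$ is the curvature of $\hat X(\cdot,t)$. In particular: 1. If $k<0$, then $X$ is an ellipse of $Q^2_+$ with curvature $k$. It is an ancient solution with $J=(-\infty,-\frac k2)$, evolving from the origin of $\mathbb{R}^3_1$. 2. If $k>0$, then $X$ is a hyperbola of $Q^2_+$ with curvature $k$, and $J=(-\frac k2,+\infty)$.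
   Context: $\mathbb{R}^3_1$ is $\mathbb{R}^3$ with the Minkowski metric $\langle u,v\rangle=-u_1v_1+u_2v_2+u_3v_3$. The light cone is $Q^2=\{p\in\mathbb{R}^3_1\setminus\{0\}:\langle p,p\rangle=0\}$ and $Q^2_+=\{p\in Q^2:p_1>0\}$. For a (smooth) spacelike curve $X$ on $Q^2$ parametrized by arc length $s$, $T=X'$ is the unit tangent field, $Y(s)$ is the unique lightlike vector orthogonal to $T(s)$ with $\langle X(s),Y(s)\rangle=1$ (the associated curve), and the curvature $k$ is defined by $T'=kX-Y$. For an arbitrary parameter, $T,Y,k$ are those obtained via arc-length reparametrization. Spacelike curves of constant curvature are (arcs of) conic sections of the cone; such a curve is called an ellipse, a parabola, or a hyperbola of $Q^2_+$ when the constant is negative, zero, or positive, respectively. A 1-parameter family of spacelike curves $\hat X:I\times J\to Q^2_+$, $J$ an interval containing $0$, with associated curves $\hat Y^t$ and non-vanishing curvatures $\hat k^t$, is a solution to the ICF with initial condition $X$ if $\langle \frac{\partial}{\partial t}\hat X^t,\hat Y^t\rangle=-1/\hat k^t$ and $\hat X^0=X$. In items 1 and 2, $J$ is the maximal time interval on which the evolution is defined. An ancient solution is one defined for $t\in(-\infty,A)$ for some $A$. Evolving from the origin means $\hat X(s,t)\to 0$ as $t\to-\infty$. *)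

theory Defs
  imports "HOL-Analysis.Analysis"
begin

definition mink :: "real^3 \<Rightarrow> real^3 \<Rightarrow> real" where
  "mink u v = - (u$1 * v$1) + u$2 * v$2 + u$3 * v$3"

definition light_cone :: "(real^3) set" where
  "light_cone = {p. p \<noteq> 0 \<and> mink p p = 0}"

definition future_cone :: "(real^3) set" where
  "future_cone = {p \<in> light_cone. p$1 > 0}"

text \<open>Intervals may be open, closed, half-open or unbounded, but not a single point, so that
  derivatives within them (one-sided at an endpoint) are unique.\<close>

definition nontrivial_interval :: "real set \<Rightarrow> bool" where
  "nontrivial_interval I \<longleftrightarrow> is_interval I \<and> (\<exists>a\<in>I. \<exists>b\<in>I. a < b)"

text \<open>\<open>D n\<close> is the \<open>n\<close>-th derivative of \<open>X\<close>.\<close>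

definition smooth_curve_on :: "real set \<Rightarrow> (real \<Rightarrow> 'a::real_normed_vector) \<Rightarrow> bool" where
  "smooth_curve_on I X \<longleftrightarrow>
     (\<exists>D :: nat \<Rightarrow> real \<Rightarrow> 'a. D 0 = X \<and>
        (\<forall>n. \<forall>s\<in>I. (D n has_vector_derivative D (Suc n) s) (at s within I)))"

text \<open>Joint smoothness in \<open>(s, t)\<close>: \<open>D i j\<close> is the partial derivative of \<open>F\<close> of order \<open>i\<close>
  in \<open>s\<close> and \<open>j\<close> in \<open>t\<close>, and all of these are jointly continuous.\<close>

definition smooth_family_on ::
    "real set \<Rightarrow> real set \<Rightarrow> (real \<Rightarrow> real \<Rightarrow> 'a::real_normed_vector) \<Rightarrow> bool" where
  "smooth_family_on I J F \<longleftrightarrow>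
     (\<exists>D :: nat \<Rightarrow> nat \<Rightarrow> real \<Rightarrow> real \<Rightarrow> 'a. D 0 0 = F \<and>
        (\<forall>i j. continuous_on (I \<times> J) (\<lambda>(s, t). D i j s t) \<and>
          (\<forall>s\<in>I. \<forall>t\<in>J.
             ((\<lambda>u. D i j u t) has_vector_derivative D (Suc i) j s t) (at s within I) \<and>
             ((\<lambda>v. D i j s v) has_vector_derivative D i (Suc j) s t) (at t within J))))"

definition velocity :: "real set \<Rightarrow> (real \<Rightarrow> 'a::real_normed_vector) \<Rightarrow> real \<Rightarrow> 'a" where
  "velocity I X s = vector_derivative X (at s within I)"

definition spacelike_curve :: "real set \<Rightarrow> (real \<Rightarrow> real^3) \<Rightarrow> bool" where
  "spacelike_curve I X \<longleftrightarrow> nontrivial_interval I \<and> smooth_curve_on I X \<and>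
     (\<forall>s\<in>I. X s \<in> future_cone \<and> mink (velocity I X s) (velocity I X s) > 0)"

definition arc_length_param :: "real set \<Rightarrow> (real \<Rightarrow> real^3) \<Rightarrow> bool" where
  "arc_length_param I X \<longleftrightarrow> (\<forall>s\<in>I. mink (velocity I X s) (velocity I X s) = 1)"

text \<open>Associated curve \<open>Y\<close> and curvature \<open>k\<close> of a spacelike curve that is already
  parametrized by arc length; its unit tangent \<open>T\<close> is \<open>velocity I X\<close>.\<close>

definition arc_associated :: "real set \<Rightarrow> (real \<Rightarrow> real^3) \<Rightarrow> real \<Rightarrow> real^3" where
  "arc_associated I X s =
     (THE y. y \<in> light_cone \<and> mink y (velocity I X s) = 0 \<and> mink (X s) y = 1)"

definition arc_curvature :: "real set \<Rightarrow> (real \<Rightarrow> real^3) \<Rightarrow> real \<Rightarrow> real" where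
  "arc_curvature I X s =
     (THE k. velocity I (velocity I X) s = k *\<^sub>R X s - arc_associated I X s)"

text \<open>\<open>X \<circ> \<phi>\<close>, defined on \<open>L\<close>, is an orientation-preserving arc-length reparametrization
  of \<open>X\<close>. It is unique up to a translation of \<open>L\<close>, so the two descriptions below do not
  depend on its choice.\<close>

definition arc_length_reparam ::
    "real set \<Rightarrow> (real \<Rightarrow> real^3) \<Rightarrow> real set \<Rightarrow> (real \<Rightarrow> real) \<Rightarrow> bool" where
  "arc_length_reparam I X L \<phi> \<longleftrightarrow> nontrivial_interval L \<and> smooth_curve_on L \<phi> \<and> \<phi> ` L = I \<and>
     (\<forall>\<sigma>\<in>L. velocity L \<phi> \<sigma> > 0) \<and> arc_length_param L (X \<circ> \<phi>)"

definition associated :: "real set \<Rightarrow> (real \<Rightarrow> real^3) \<Rightarrow> real \<Rightarrow> real^3" where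
  "associated I X u =
     (THE y. \<exists>L \<phi> \<sigma>. arc_length_reparam I X L \<phi> \<and> \<sigma> \<in> L \<and> \<phi> \<sigma> = u \<and>
        y = arc_associated L (X \<circ> \<phi>) \<sigma>)"

definition curvature :: "real set \<Rightarrow> (real \<Rightarrow> real^3) \<Rightarrow> real \<Rightarrow> real" where
  "curvature I X u =
     (THE k. \<exists>L \<phi> \<sigma>. arc_length_reparam I X L \<phi> \<and> \<sigma> \<in> L \<and> \<phi> \<sigma> = u \<and>
        k = arc_curvature L (X \<circ> \<phi>) \<sigma>)"

text \<open>The conics of the cone are by definition its spacelike curves of constant curvature,
  named according to the sign of the constant; arcs of conics are included.\<close>

definition ellipse_with_curvature :: "real set \<Rightarrow> (real \<Rightarrow> real^3) \<Rightarrow> real \<Rightarrow> bool" where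
  "ellipse_with_curvature I X c \<longleftrightarrow>
     spacelike_curve I X \<and> (\<forall>s\<in>I. curvature I X s = c) \<and> c < 0"

definition hyperbola_with_curvature :: "real set \<Rightarrow> (real \<Rightarrow> real^3) \<Rightarrow> real \<Rightarrow> bool" where
  "hyperbola_with_curvature I X c \<longleftrightarrow>
     spacelike_curve I X \<and> (\<forall>s\<in>I. curvature I X s = c) \<and> c > 0"

definition ICF_solution ::
    "real set \<Rightarrow> real set \<Rightarrow> (real \<Rightarrow> real \<Rightarrow> real^3) \<Rightarrow> (real \<Rightarrow> real^3) \<Rightarrow> bool" where
  "ICF_solution I J F X \<longleftrightarrow>
     nontrivial_interval J \<and> 0 \<in> J \<and> smooth_family_on I J F \<and>
     (\<forall>t\<in>J. spacelike_curve I (\<lambda>s. F s t)) \<and>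
     (\<forall>s\<in>I. \<forall>t\<in>J. curvature I (\<lambda>u. F u t) s \<noteq> 0) \<and>
     (\<forall>s\<in>I. \<forall>t\<in>J. mink (vector_derivative (F s) (at t within J)) (associated I (\<lambda>u. F u t) s)
                    = - 1 / curvature I (\<lambda>u. F u t) s) \<and>
     (\<forall>s\<in>I. F s 0 = X s)"

text \<open>\<open>J\<close> is the maximal time interval of the evolution \<open>F\<close>: no solution on a larger
  interval extends it.\<close>

definition maximal_ICF_solution ::
    "real set \<Rightarrow> real set \<Rightarrow> (real \<Rightarrow> real \<Rightarrow> real^3) \<Rightarrow> (real \<Rightarrow> real^3) \<Rightarrow> bool" where
  "maximal_ICF_solution I J F X \<longleftrightarrow> ICF_solution I J F X \<and>
     (\<forall>J' G. ICF_solution I J' G X \<and> J \<subseteq> J' \<and> (\<forall>s\<in>I. \<forall>t\<in>J. G s t = F s t) \<longrightarrow> J' = J)"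

definition ancient_solution ::
    "real set \<Rightarrow> real set \<Rightarrow> (real \<Rightarrow> real \<Rightarrow> real^3) \<Rightarrow> (real \<Rightarrow> real^3) \<Rightarrow> bool" where
  "ancient_solution I J F X \<longleftrightarrow> ICF_solution I J F X \<and> (\<exists>A. J = {..<A})"

definition evolves_from_origin ::
    "real set \<Rightarrow> (real \<Rightarrow> real \<Rightarrow> real^3) \<Rightarrow> bool" where
  "evolves_from_origin I F \<longleftrightarrow> (\<forall>s\<in>I. ((\<lambda>t. F s t) \<longlongrightarrow> 0) at_bot)"

end

theory Submission
  imports Defs
begin

text \<open>A homothety by \<open>a\<close> divides the associated curve by \<open>a\<close> and the curvature by \<open>a\<^sup>2\<close>, so for
  \<open>f(t) X(s)\<close> the flow equation reads \<open>f' / f = - f\<^sup>2 / k\<close>. At \<open>t = 0\<close> this forces \<open>k\<close> to be constant,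
  and then \<open>1 / f\<^sup>2\<close> has constant derivative \<open>2 / k\<close>. The factor \<open>f\<close> blows up exactly when
  \<open>2 t / k + 1\<close> reaches zero, which bounds the maximal interval.\<close>

section \<open>The Minkowski form and derivatives along intervals\<close>

lemma mink_scaleR [simp]: "mink (a *\<^sub>R u) v = a * mink u v" "mink u (a *\<^sub>R v) = a * mink u v"
  by (simp_all add: mink_def algebra_simps)

lemma mink_diff: "mink (u - v) w = mink u w - mink v w" "mink w (u - v) = mink w u - mink w v"
  by (simp_all add: mink_def algebra_simps)

lemma mink_add: "mink (u + v) w = mink u w + mink v w" "mink w (u + v) = mink w u + mink w v"
  by (simp_all add: mink_def algebra_simps)

lemma mink_commute: "mink u v = mink v u"
  by (simp add: mink_def mult.commute)

lemma has_real_derivative_mink: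
  assumes "(U has_vector_derivative u) (at s within I)" "(V has_vector_derivative v) (at s within I)"
  shows "((\<lambda>s. mink (U s) (V s)) has_real_derivative mink u (V s) + mink (U s) v) (at s within I)"
proof -
  have c: "((\<lambda>s. W s $ i) has_real_derivative w $ i) (at s within I)"
    if "(W has_vector_derivative w) (at s within I)" for W and w :: "real^3" and i
    using bounded_linear.has_vector_derivative[OF bounded_linear_vec_nth that]
    by (simp add: has_real_derivative_iff_has_vector_derivative)
  show ?thesis
    unfolding mink_def
    by (rule derivative_eq_intros c[OF assms(1)] c[OF assms(2)] refl)+ (simp add: algebra_simps)
qed

text \<open>A connected set with more than one point has no isolated points. This makes derivatives
  within \<open>I\<close> unique, one-sided ones included.\<close>

lemma nontrivial_interval_at_within:
  assumes "nontrivial_interval I" "s \<in> I"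
  shows "at s within I \<noteq> bot"
proof -
  obtain a b where "a \<in> I" "b \<in> I" "a < b" "is_interval I"
    using assms by (auto simp: nontrivial_interval_def)
  then have "s islimpt I"
    by (intro connected_imp_perfect) (use assms in \<open>auto simp: is_interval_connected\<close>)
  then show ?thesis
    by (simp add: trivial_limit_within)
qed

lemma velocity_eq:
  assumes "nontrivial_interval I" "s \<in> I" "(X has_vector_derivative v) (at s within I)"
  shows "velocity I X s = v"
  unfolding velocity_def
  by (rule vector_derivative_within[OF nontrivial_interval_at_within[OF assms(1,2)] assms(3)])

text \<open>Derivatives within \<open>I\<close> ignore values off \<open>I\<close>; this matters
  because \<open>velocity I X\<close> is identified with explicit formulas only on
  \<open>I\<close>.\<close>

lemma velocity_cong:
  assumes "nontrivial_interval I" "s \<in> I" "(X has_vector_derivative v) (at s within I)"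
    and "\<And>u. u \<in> I \<Longrightarrow> Y u = X u"
  shows "velocity I Y s = v"
  by (rule velocity_eq[OF assms(1,2)])
     (rule has_vector_derivative_transform[OF assms(2) _ assms(3)], simp add: assms(4))

text \<open>Product rule for a constant pairing, combined with uniqueness of the derivative; the
  source of the frame identities.\<close>

lemma mink_derivative_zero:
  assumes "nontrivial_interval I" "s \<in> I"
    and "(U has_vector_derivative u) (at s within I)" "(V has_vector_derivative v) (at s within I)"
    and "\<And>x. x \<in> I \<Longrightarrow> mink (U x) (V x) = c"
  shows "mink u (V s) + mink (U s) v = 0"
proof -
  have "((\<lambda>x. mink (U x) (V x)) has_vector_derivative mink u (V s) + mink (U s) v) (at s within I)"
    using has_real_derivative_mink[OF assms(3,4)]
    by (simp add: has_real_derivative_iff_has_vector_derivative)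
  from velocity_eq[OF assms(1,2) this] show ?thesis
    using velocity_cong[OF assms(1,2) has_vector_derivative_const[of c] assms(5)] by simp
qed

section \<open>The null frame of a curve on the light cone\<close>

text \<open>The orthogonal complement of \<open>X\<close> and \<open>T\<close> is spanned by the null vector \<open>X\<close>: modulo \<open>X\<close>,
  every vector orthogonal to \<open>X\<close> lies on one spacelike line, which \<open>T\<close> spans.\<close>

lemma orthogonal_null_tangent:
  assumes "X \<in> future_cone" "mink X T = 0" "mink T T = 1"
    and "mink V X = 0" "mink V T = 0"
  shows "\<exists>a. V = a *\<^sub>R X"
proof -
  define r where "r = X $ 1"
  have r: "r > 0" and XX: "mink X X = 0"
    using assms by (auto simp: r_def future_cone_def light_cone_def)
  \<comment> \<open>Since \<open>X\<close> is orthogonal to itself, \<open>V\<close> and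
    \<open>T\<close>, subtracting multiples of it changes no pairing. With first coordinate zero,
    the form becomes Euclidean in the other two coordinates.\<close>
  define W where "W = V - (V$1 / r) *\<^sub>R X"
  define S where "S = T - (T$1 / r) *\<^sub>R X"
  have z: "W $ 1 = 0" "S $ 1 = 0"
    using r by (simp_all add: W_def S_def r_def)
  have "mink W X = 0" "mink S X = 0" "mink W S = 0" "mink S S = 1"
    using assms XX by (simp_all add: W_def S_def mink_diff mink_commute)
  then have e: "W$2 * X$2 + W$3 * X$3 = 0" "S$2 * X$2 + S$3 * X$3 = 0"
     "W$2 * S$2 + W$3 * S$3 = 0" "S$2 * S$2 + S$3 * S$3 = 1"
    using z by (simp_all add: mink_def)
  have x: "X$2 * X$2 + X$3 * X$3 = r * r"
    using XX by (simp add: mink_def r_def)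
  \<comment> \<open>The planar determinant of \<open>X\<close> and \<open>S\<close>; Lagrange's
    identity gives \<open>d^2 = r^2\<close>.\<close>
  define d where "d = X$2 * S$3 - X$3 * S$2"
  have "d * d = (X$2 * X$2 + X$3 * X$3) * (S$2 * S$2 + S$3 * S$3) - (S$2 * X$2 + S$3 * X$3)^2"
    by (simp add: d_def algebra_simps power2_eq_square)
  then have d: "d \<noteq> 0"
    using r e x by auto
  \<comment> \<open>Cramer's rule for the planar system saying that \<open>W\<close> is orthogonal
    to both \<open>X\<close> and \<open>S\<close>.\<close>
  have "d * W$2 = S$3 * (W$2 * X$2 + W$3 * X$3) - X$3 * (W$2 * S$2 + W$3 * S$3)"
    "d * W$3 = X$2 * (W$2 * S$2 + W$3 * S$3) - S$2 * (W$2 * X$2 + W$3 * X$3)"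
    by (simp_all add: d_def algebra_simps)
  then have "d * W$2 = 0" "d * W$3 = 0"
    unfolding e by simp_all
  then have "W = 0"
    using d z by (simp add: vec_eq_iff forall_3)
  then show ?thesis
    by (auto simp: W_def)
qed

text \<open>Existence corrects an explicit null vector along \<open>T\<close> and \<open>X\<close>.
  Two solutions differ by a multiple of \<open>X\<close>, and nullity forces that multiple to be
  zero.\<close>

lemma associated_vector_ex1:
  assumes "X \<in> future_cone" "mink X T = 0" "mink T T = 1"
  shows "\<exists>!y. y \<in> light_cone \<and> mink y T = 0 \<and> mink X y = 1"
proof -
  have r: "X $ 1 > 0" and XX: "mink X X = 0"
    using assms by (auto simp: future_cone_def light_cone_def)
  \<comment> \<open>Reversing the sign of the first coordinate of \<open>X\<close> keeps it null and
    gives pairing \<open>2 * (X$1)^2\<close> with \<open>X\<close>, whence the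
    normalization.\<close>
  define Y0 :: "real^3" where "Y0 = (1 / (2 * (X$1)^2)) *\<^sub>R vector [- X$1, X$2, X$3]"
  have x: "X$2 * X$2 + X$3 * X$3 = X$1 * X$1"
    using XX by (simp add: mink_def)
  have Y0: "mink X Y0 = 1" "mink Y0 Y0 = 0"
    unfolding Y0_def mink_scaleR using r x
    by (simp_all add: mink_def power2_eq_square field_simps)
  define m where "m = mink Y0 T"
  \<comment> \<open>Subtracting \<open>m T\<close> makes the vector orthogonal to \<open>T\<close>
    but changes its square to \<open>- m^2\<close>; the multiple of \<open>X\<close> restores
    nullity. Neither term affects the pairing with \<open>X\<close>.\<close>
  define Y where "Y = Y0 - m *\<^sub>R T + (m^2 / 2) *\<^sub>R X"
  have Y: "mink Y T = 0" "mink X Y = 1" "mink Y Y = 0"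
    using assms XX Y0 mink_commute[of T X] mink_commute[of Y0 X] mink_commute[of T Y0]
    by (simp_all add: Y_def mink_diff mink_add m_def[symmetric] power2_eq_square algebra_simps)
  show ?thesis
  proof (rule ex1I[of _ Y])
    have "Y \<noteq> 0"
      using Y by (auto simp: mink_def)
    then show "Y \<in> light_cone \<and> mink Y T = 0 \<and> mink X Y = 1"
      using Y by (simp add: light_cone_def)
  next
    fix y assume y: "y \<in> light_cone \<and> mink y T = 0 \<and> mink X y = 1"
    then have "mink (y - Y) X = 0" "mink (y - Y) T = 0"
      using Y by (simp_all add: mink_diff mink_commute[of _ X])
    from orthogonal_null_tangent[OF assms this] obtain a where a: "y = Y + a *\<^sub>R X"
      by (metis add_diff_cancel_left' diff_add_cancel add.commute)
    have "mink y y = 2 * a"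
      using Y XX mink_commute[of Y X] by (simp add: a mink_add)
    with y have "a = 0"
      by (simp add: light_cone_def)
    with a show "y = Y" by simp
  qed
qed

section \<open>Homothetic images\<close>

context
  fixes I :: "real set" and X :: "real \<Rightarrow> real^3"
  assumes sc: "spacelike_curve I X" and al: "arc_length_param I X"
begin

lemma interval: "nontrivial_interval I"
  using sc by (simp add: spacelike_curve_def)

lemma has_velocity:
  assumes "s \<in> I"
  shows "(X has_vector_derivative velocity I X s) (at s within I)"
    and "(velocity I X has_vector_derivative velocity I (velocity I X) s) (at s within I)"
proof -
  obtain D where "D 0 = X" and
    D: "\<And>n s. s \<in> I \<Longrightarrow> (D n has_vector_derivative D (Suc n) s) (at s within I)"
    using sc by (auto simp: spacelike_curve_def smooth_curve_on_def)
  then have X: "(X has_vector_derivative D 1 u) (at u within I)" if "u \<in> I" for u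
    using that by (metis One_nat_def)
  have v: "velocity I X u = D 1 u" if "u \<in> I" for u
    using velocity_eq[OF interval that X[OF that]] .
  have "(velocity I X has_vector_derivative D (Suc 1) s) (at s within I)"
    by (rule has_vector_derivative_transform[OF assms v D]) (use assms in auto)
  then show "(velocity I X has_vector_derivative velocity I (velocity I X) s) (at s within I)"
    using velocity_eq[OF interval assms] by metis
  show "(X has_vector_derivative velocity I X s) (at s within I)"
    using X[OF assms] v[OF assms] by simp
qed

text \<open>Differentiate \<open><X,X> = 0\<close>, \<open><T,T> = 1\<close> and
  \<open><X,T> = 0\<close> in turn; the last gives \<open><T',X> = - <T,T>\<close>.\<close>

lemma frame:
  assumes "s \<in> I"
  shows "X s \<in> future_cone" "mink (X s) (velocity I X s) = 0"
    "mink (velocity I X s) (velocity I X s) = 1"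
    "mink (velocity I (velocity I X) s) (velocity I X s) = 0"
    "mink (velocity I (velocity I X) s) (X s) = - 1"
proof -
  have cone: "X u \<in> future_cone" if "u \<in> I" for u
    using sc that by (simp add: spacelike_curve_def)
  have XX: "mink (X u) (X u) = 0" if "u \<in> I" for u
    using cone[OF that] by (simp add: future_cone_def light_cone_def)
  have TT: "mink (velocity I X u) (velocity I X u) = 1" if "u \<in> I" for u
    using al that by (simp add: arc_length_param_def)
  have XT: "mink (X u) (velocity I X u) = 0" if "u \<in> I" for u
    using mink_derivative_zero[OF interval that has_velocity(1)[OF that] has_velocity(1)[OF that] XX]
    by (simp add: mink_commute)
  show "X s \<in> future_cone" "mink (X s) (velocity I X s) = 0"
    "mink (velocity I X s) (velocity I X s) = 1"
    using cone XT TT assms by auto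
  show "mink (velocity I (velocity I X) s) (velocity I X s) = 0"
    using mink_derivative_zero[OF interval assms has_velocity(2)[OF assms] has_velocity(2)[OF assms] TT]
    by (simp add: mink_commute)
  show "mink (velocity I (velocity I X) s) (X s) = - 1"
    using mink_derivative_zero[OF interval assms has_velocity(1)[OF assms] has_velocity(2)[OF assms] XT]
      TT[OF assms] by (simp add: mink_commute)
qed

lemma arc_associated:
  assumes "s \<in> I"
  shows "arc_associated I X s \<in> light_cone" "mink (arc_associated I X s) (velocity I X s) = 0"
    "mink (X s) (arc_associated I X s) = 1"
  using theI'[OF associated_vector_ex1[OF frame(1-3)[OF assms]]] unfolding arc_associated_def by auto

text \<open>Both \<open>T'\<close> and \<open>Y\<close> are orthogonal to \<open>T\<close>, and
  their pairings with \<open>X\<close> are -1 and 1. Hence \<open>T' + Y\<close> is a multiple of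
  \<open>X\<close>, with unique coefficient because \<open>X\<close> is nonzero.\<close>

lemma arc_curvature:
  assumes "s \<in> I"
  shows "velocity I (velocity I X) s = arc_curvature I X s *\<^sub>R X s - arc_associated I X s"
proof -
  have "mink (velocity I (velocity I X) s + arc_associated I X s) (X s) = 0"
    "mink (velocity I (velocity I X) s + arc_associated I X s) (velocity I X s) = 0"
    using frame[OF assms] arc_associated[OF assms] by (simp_all add: mink_add mink_commute[of _ "X s"])
  from orthogonal_null_tangent[OF frame(1-3)[OF assms] this]
  obtain c where c: "velocity I (velocity I X) s = c *\<^sub>R X s - arc_associated I X s"
    by (metis add_diff_cancel)
  have "X s \<noteq> 0"
    using frame(1)[OF assms] by (auto simp: future_cone_def)
  then have "arc_curvature I X s = c"
    unfolding arc_curvature_def c by (intro the_equality) auto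
  with c show ?thesis by simp
qed

text \<open>Any arc-length reparametrization \<open>\<phi>\<close> of \<open>a X\<close> has constant speed \<open>1/a\<close>, so it need not be
  determined explicitly.\<close>

lemma homothety_reparam:
  assumes "a > 0" and r: "arc_length_reparam I (\<lambda>u. a *\<^sub>R X u) L \<phi>" and "\<sigma> \<in> L"
  defines "Z \<equiv> (\<lambda>u. a *\<^sub>R X u) \<circ> \<phi>"
  shows "arc_associated L Z \<sigma> = (1 / a) *\<^sub>R arc_associated I X (\<phi> \<sigma>)"
    and "arc_curvature L Z \<sigma> = arc_curvature I X (\<phi> \<sigma>) / a^2"
proof -
  have L: "nontrivial_interval L" and im: "\<phi> ` L = I"
    using r by (auto simp: arc_length_reparam_def)
  have in_I: "\<phi> u \<in> I" if "u \<in> L" for u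
    using im that by auto
  obtain D where "D 0 = \<phi>" and
    D: "\<And>n s. s \<in> L \<Longrightarrow> (D n has_vector_derivative D (Suc n) s) (at s within L)"
    using r by (auto simp: arc_length_reparam_def smooth_curve_on_def)
  then have \<phi>: "(\<phi> has_vector_derivative D 1 u) (at u within L)" if "u \<in> L" for u
    using that by (metis One_nat_def)
  have chain: "(G \<circ> \<phi> has_vector_derivative D 1 u *\<^sub>R g) (at u within L)"
    if "u \<in> L" "(G has_vector_derivative g) (at (\<phi> u) within I)" for u G and g :: "real^3"
    using vector_diff_chain_within[OF \<phi>[OF that(1)]] that(2) im by simp
  have Z: "velocity L Z u = (a * D 1 u) *\<^sub>R velocity I X (\<phi> u)" if "u \<in> L" for u
  proof -
    have "((\<lambda>u. a *\<^sub>R X u) has_vector_derivative a *\<^sub>R velocity I X (\<phi> u)) (at (\<phi> u) within I)"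
      by (intro bounded_linear.has_vector_derivative[OF bounded_linear_scaleR_right]
          has_velocity in_I that)
    from velocity_eq[OF L that chain[OF that this]] show ?thesis
      by (simp add: Z_def mult.commute)
  qed
  \<comment> \<open>Unit length gives \<open>(a \<phi>')^2 = 1\<close>; preservation of orientation
    selects the positive root.\<close>
  have speed: "D 1 u = 1 / a" if "u \<in> L" for u
  proof -
    have "D 1 u > 0"
      using r that velocity_eq[OF L that \<phi>[OF that]] by (auto simp: arc_length_reparam_def)
    moreover have "mink (velocity L Z u) (velocity L Z u) = 1"
      using r that by (simp add: arc_length_reparam_def arc_length_param_def Z_def)
    then have "(a * D 1 u) * (a * D 1 u) = 1"
      using frame(3)[OF in_I[OF that]] by (simp add: Z[OF that])
    ultimately have "a * D 1 u = 1"
      using \<open>a > 0\<close> by (metis mult_pos_pos square_eq_1_iff less_le_not_le neg_less_0_iff_less zero_less_one)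
    then show ?thesis
      using \<open>a > 0\<close> by (simp add: field_simps)
  qed
  have v: "velocity L Z u = velocity I X (\<phi> u)" if "u \<in> L" for u
    using Z[OF that] speed[OF that] \<open>a > 0\<close> by simp
  have w: "velocity L (velocity L Z) \<sigma> = (1 / a) *\<^sub>R velocity I (velocity I X) (\<phi> \<sigma>)"
    using velocity_cong[OF L \<open>\<sigma> \<in> L\<close> chain[OF \<open>\<sigma> \<in> L\<close> has_velocity(2)[OF in_I[OF \<open>\<sigma> \<in> L\<close>]]]] v
      speed[OF \<open>\<sigma> \<in> L\<close>] by simp
  let ?s = "\<phi> \<sigma>" let ?Y = "arc_associated I X ?s"
  have s: "?s \<in> I" using in_I \<open>\<sigma> \<in> L\<close> .
  have cone: "Z \<sigma> \<in> future_cone"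
    using frame(1)[OF s] \<open>a > 0\<close> by (simp add: Z_def future_cone_def light_cone_def)
  have ex1: "\<exists>!y. y \<in> light_cone \<and> mink y (velocity L Z \<sigma>) = 0 \<and> mink (Z \<sigma>) y = 1"
    using frame[OF s] v[OF \<open>\<sigma> \<in> L\<close>] by (intro associated_vector_ex1 cone) (auto simp: Z_def)
  \<comment> \<open>The unit tangent is unchanged, so \<open>Y / a\<close> still meets the defining
    conditions: \<open><a X, Y / a> = 1\<close>.\<close>
  show assoc: "arc_associated L Z \<sigma> = (1 / a) *\<^sub>R ?Y"
    unfolding arc_associated_def[of L]
    by (rule the1_equality[OF ex1])
       (use arc_associated[OF s] \<open>a > 0\<close> v[OF \<open>\<sigma> \<in> L\<close>] in \<open>auto simp: Z_def light_cone_def\<close>)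
  have "Z \<sigma> \<noteq> 0"
    using cone by (auto simp: future_cone_def)
  \<comment> \<open>Rewrite \<open>(1/a) (k X - Y)\<close> in the scaled frame:
    \<open>(k / a^2) (a X) - Y / a\<close>.\<close>
  moreover have "velocity L (velocity L Z) \<sigma> =
      (arc_curvature I X ?s / a^2) *\<^sub>R Z \<sigma> - (1 / a) *\<^sub>R ?Y"
    unfolding w arc_curvature[OF s] using \<open>a > 0\<close>
    by (simp add: Z_def power2_eq_square scaleR_diff_right)
  ultimately show "arc_curvature L Z \<sigma> = arc_curvature I X ?s / a^2"
    unfolding arc_curvature_def[of L] assoc by (intro the_equality) auto
qed

text \<open>Scaling by \<open>a\<close> multiplies arc length by \<open>a\<close>. This witness
  makes the descriptions defining \<open>associated\<close> and \<open>curvature\<close>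
  nonempty.\<close>

lemma homothety_reparam_exists:
  assumes "a > 0"
  shows "arc_length_reparam I (\<lambda>u. a *\<^sub>R X u) ((*) a ` I) (\<lambda>\<sigma>. \<sigma> / a)"
proof -
  let ?L = "(*) a ` I" and ?\<phi> = "\<lambda>\<sigma>. \<sigma> / a"
  have L: "nontrivial_interval ?L"
    using interval assms unfolding nontrivial_interval_def
    by (auto simp: is_interval_connected_1 intro!: connected_continuous_image continuous_intros)
  have im: "?\<phi> ` ?L = I"
    using assms by (auto simp: image_image)
  have d: "(?\<phi> has_vector_derivative 1 / a) (at u within S)" for u S
    unfolding has_real_derivative_iff_has_vector_derivative[symmetric]
    using assms by (auto intro!: derivative_eq_intros)
  have smooth: "smooth_curve_on ?L ?\<phi>"
    unfolding smooth_curve_on_def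
    by (rule exI[of _ "\<lambda>n::nat. if n = 0 then ?\<phi> else if n = 1 then (\<lambda>_. 1 / a) else (\<lambda>_. 0)"])
       (use d in auto)
  have v: "velocity ?L ((\<lambda>u. a *\<^sub>R X u) \<circ> ?\<phi>) \<sigma> = velocity I X (\<sigma> / a)" if "\<sigma> \<in> ?L" for \<sigma>
  proof -
    have s: "\<sigma> / a \<in> I" using that im by blast
    have "((\<lambda>u. a *\<^sub>R X u) has_vector_derivative a *\<^sub>R velocity I X (\<sigma> / a))
        (at (\<sigma> / a) within ?\<phi> ` ?L)"
      unfolding im
      by (intro bounded_linear.has_vector_derivative[OF bounded_linear_scaleR_right] has_velocity s)
    from velocity_eq[OF L that vector_diff_chain_within[OF d this]] show ?thesis
      using assms by simp
  qed
  have sI: "\<sigma> / a \<in> I" if "\<sigma> \<in> ?L" for \<sigma>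
    using that im by blast
  show ?thesis
    unfolding arc_length_reparam_def arc_length_param_def
    using L smooth im velocity_eq[OF L _ d] assms v frame(3) sI by auto
qed

text \<open>The definite descriptions range over all arc-length reparametrizations. One exists, and
  \<open>homothety_reparam\<close> computes the same value from each of them.\<close>

lemma homothety:
  assumes "a > 0" "s \<in> I"
  shows "associated I (\<lambda>u. a *\<^sub>R X u) s = (1 / a) *\<^sub>R arc_associated I X s"
    and "curvature I (\<lambda>u. a *\<^sub>R X u) s = arc_curvature I X s / a^2"
proof -
  note ex = homothety_reparam_exists[OF assms(1)]
  note reparam = homothety_reparam[OF assms(1)]
  have \<sigma>: "a * s \<in> (*) a ` I" "a * s / a = s"
    using assms by auto
  show "associated I (\<lambda>u. a *\<^sub>R X u) s = (1 / a) *\<^sub>R arc_associated I X s"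
    unfolding associated_def
  proof (rule the_equality)
    show "\<exists>L \<phi> \<sigma>. arc_length_reparam I (\<lambda>u. a *\<^sub>R X u) L \<phi> \<and> \<sigma> \<in> L \<and> \<phi> \<sigma> = s \<and>
        (1 / a) *\<^sub>R arc_associated I X s = arc_associated L ((\<lambda>u. a *\<^sub>R X u) \<circ> \<phi>) \<sigma>"
      by (rule exI, rule exI, rule exI, intro conjI, rule ex, rule \<sigma>(1), rule \<sigma>(2))
         (simp only: reparam(1)[OF ex \<sigma>(1)] \<sigma>(2))
  qed (elim exE conjE, simp only: reparam(1))
  show "curvature I (\<lambda>u. a *\<^sub>R X u) s = arc_curvature I X s / a^2"
    unfolding curvature_def
  proof (rule the_equality)
    show "\<exists>L \<phi> \<sigma>. arc_length_reparam I (\<lambda>u. a *\<^sub>R X u) L \<phi> \<and> \<sigma> \<in> L \<and> \<phi> \<sigma> = s \<and>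
        arc_curvature I X s / a^2 = arc_curvature L ((\<lambda>u. a *\<^sub>R X u) \<circ> \<phi>) \<sigma>"
      by (rule exI, rule exI, rule exI, intro conjI, rule ex, rule \<sigma>(1), rule \<sigma>(2))
         (simp only: reparam(2)[OF ex \<sigma>(1)] \<sigma>(2))
  qed (elim exE conjE, simp only: reparam(2))
qed

lemma spacelike_curve_homothety:
  assumes "a > 0"
  shows "spacelike_curve I (\<lambda>u. a *\<^sub>R X u)"
proof -
  obtain D where D0: "D 0 = X" and
    D: "\<And>n s. s \<in> I \<Longrightarrow> (D n has_vector_derivative D (Suc n) s) (at s within I)"
    using sc by (auto simp: spacelike_curve_def smooth_curve_on_def)
  have "smooth_curve_on I (\<lambda>u. a *\<^sub>R X u)"
    unfolding smooth_curve_on_def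
    by (rule exI[of _ "\<lambda>n u. a *\<^sub>R D n u"])
       (auto simp: D0 intro!: bounded_linear.has_vector_derivative[OF bounded_linear_scaleR_right] D)
  moreover have "velocity I (\<lambda>u. a *\<^sub>R X u) s = a *\<^sub>R velocity I X s" if "s \<in> I" for s
    by (intro velocity_eq interval that
        bounded_linear.has_vector_derivative[OF bounded_linear_scaleR_right] has_velocity)
  ultimately show ?thesis
    using interval frame assms by (auto simp: spacelike_curve_def future_cone_def light_cone_def)
qed

end

section \<open>The homothetic flow\<close>

lemma smooth_family_on_scaleR:
  assumes "smooth_curve_on J f" "smooth_curve_on I X"
  shows "smooth_family_on I J (\<lambda>s t. f t *\<^sub>R X s)"
proof -
  obtain A where A0: "A 0 = f" and
    A: "\<And>n s. s \<in> J \<Longrightarrow> (A n has_vector_derivative A (Suc n) s) (at s within J)"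
    using assms(1) by (auto simp: smooth_curve_on_def)
  obtain D where D0: "D 0 = X" and
    D: "\<And>n s. s \<in> I \<Longrightarrow> (D n has_vector_derivative D (Suc n) s) (at s within I)"
    using assms(2) by (auto simp: smooth_curve_on_def)
  have cA: "continuous_on J (A j)" for j
    unfolding continuous_on_eq_continuous_within using A[THEN has_vector_derivative_continuous] by simp
  have cD: "continuous_on I (D j)" for j
    unfolding continuous_on_eq_continuous_within using D[THEN has_vector_derivative_continuous] by simp
  have "continuous_on (I \<times> J) (\<lambda>p. A j (snd p) *\<^sub>R D i (fst p))" for i j
    by (intro continuous_on_scaleR continuous_on_compose2[OF cA] continuous_on_compose2[OF cD]
        continuous_intros) auto
  moreover have "((\<lambda>v. A j v *\<^sub>R D i s) has_vector_derivative A (Suc j) t *\<^sub>R D i s) (at t within J)"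
    if "t \<in> J" for i j s t
    by (intro bounded_linear.has_vector_derivative[OF bounded_linear_scaleR_left] A that)
  moreover have "((\<lambda>u. A j t *\<^sub>R D i u) has_vector_derivative A j t *\<^sub>R D (Suc i) s) (at s within I)"
    if "s \<in> I" for i j s t
    by (intro bounded_linear.has_vector_derivative[OF bounded_linear_scaleR_right] D that)
  ultimately show ?thesis
    unfolding smooth_family_on_def
    by (intro exI[of _ "\<lambda>i j s t. A j t *\<^sub>R D i s"]) (auto simp: A0 D0 case_prod_beta)
qed

lemma smooth_curve_on_inverse_sqrt_affine:
  fixes f :: "real \<Rightarrow> real"
  assumes pos: "\<And>t. t \<in> J \<Longrightarrow> m * t + 1 > 0"
    and f: "\<And>t. t \<in> J \<Longrightarrow> f t = 1 / sqrt (m * t + 1)"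
  shows "smooth_curve_on J f"
proof -
  \<comment> \<open>The \<open>j\<close>-th derivative of \<open>(m t + 1)^(-1/2)\<close>: each
    differentiation contributes its current exponent and a factor \<open>m\<close>.\<close>
  define h where
    "h j t = (\<Prod>i<j. - 1/2 - real i) * m^j * (m * t + 1) powr (- 1/2 - real j)" for j t
  have h: "(h j has_vector_derivative h (Suc j) t) (at t within J)" if "t \<in> J" for j t
  proof -
    have "((\<lambda>t. (m * t + 1) powr (- 1/2 - real j)) has_real_derivative
        (- 1/2 - real j) * (m * t + 1) powr (- 1/2 - real j - 1) * m) (at t within J)"
      using DERIV_fun_powr[of "\<lambda>t. m * t + 1" m t "- 1/2 - real j"] pos[OF that]
      by (auto intro: has_field_derivative_at_within intro!: derivative_eq_intros)
    from DERIV_cmult[OF this, of "(\<Prod>i<j. - 1/2 - real i) * m^j"] show ?thesis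
      unfolding has_real_derivative_iff_has_vector_derivative[symmetric]
      by (simp add: h_def [abs_def] algebra_simps)
  qed
  have h_0: "f t = h 0 t" if "t \<in> J" for t
    using pos[OF that] by (simp add: f[OF that] h_def powr_minus_divide powr_half_sqrt)
  show ?thesis
    unfolding smooth_curve_on_def
    \<comment> \<open>The zeroth entry must be \<open>f\<close> itself as a function, whereas
      \<open>h 0\<close> agrees with \<open>f\<close> only on \<open>J\<close>.\<close>
    by (rule exI[of _ "\<lambda>n. if n = 0 then f else h n"])
       (use h has_vector_derivative_transform[OF _ h_0 h] in auto)
qed

lemma ICF_solution_time_derivative:
  assumes "ICF_solution I J F X" "s \<in> I" "t \<in> J"
  obtains v where "(F s has_vector_derivative v) (at t within J)"
proof -
  obtain D where "D 0 0 = F" and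
    D: "\<And>i j s t. s \<in> I \<Longrightarrow> t \<in> J \<Longrightarrow> (D i j s has_vector_derivative D i (Suc j) s t) (at t within J)"
    using assms(1) by (auto simp: ICF_solution_def smooth_family_on_def)
  with D[OF assms(2,3), of 0 0] show thesis
    by (intro that) simp
qed

section \<open>The flow equation along a homothetic family\<close>

context
  fixes I :: "real set" and X :: "real \<Rightarrow> real^3"
  assumes sc: "spacelike_curve I X" and al: "arc_length_param I X"
begin

text \<open>The time derivative is \<open>f' X\<close>, the associated vector is
  \<open>Y / f\<close>, and \<open><X,Y> = 1\<close>.\<close>

lemma homothetic_ICF_equation:
  assumes "nontrivial_interval J" "t \<in> J" "s \<in> I" "f t > 0"
    and "(f has_real_derivative f') (at t within J)"
  shows "mink (vector_derivative (\<lambda>t. f t *\<^sub>R X s) (at t within J))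
           (associated I (\<lambda>u. f t *\<^sub>R X u) s) = f' / f t"
proof -
  have "((\<lambda>t. f t *\<^sub>R X s) has_vector_derivative f' *\<^sub>R X s) (at t within J)"
    using assms(5) unfolding has_real_derivative_iff_has_vector_derivative
    by (rule bounded_linear.has_vector_derivative[OF bounded_linear_scaleR_left])
  then have "vector_derivative (\<lambda>t. f t *\<^sub>R X s) (at t within J) = f' *\<^sub>R X s"
    using velocity_eq[OF assms(1,2)] by (simp add: velocity_def)
  then show ?thesis
    by (simp add: homothety[OF sc al assms(4,3)] arc_associated[OF sc al assms(3)])
qed

lemma homothetic_ICF_solutionI:
  assumes "nontrivial_interval J" "0 \<in> J" "c \<noteq> 0"
    and k: "\<And>s. s \<in> I \<Longrightarrow> arc_curvature I X s = c"
    and pos: "\<And>t. t \<in> J \<Longrightarrow> 2 * t / c + 1 > 0"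
    and f: "\<And>t. t \<in> J \<Longrightarrow> f t = 1 / sqrt (2 * t / c + 1)"
  shows "ICF_solution I J (\<lambda>s t. f t *\<^sub>R X s) X"
proof -
  have fpos: "f t > 0" if "t \<in> J" for t
    using pos[OF that] by (simp add: f[OF that])
  have "smooth_curve_on J f"
    by (rule smooth_curve_on_inverse_sqrt_affine[where m = "2 / c"]) (use pos f in auto)
  moreover have "smooth_curve_on I X"
    using sc by (simp add: spacelike_curve_def)
  ultimately have smooth: "smooth_family_on I J (\<lambda>s t. f t *\<^sub>R X s)"
    by (rule smooth_family_on_scaleR)
  \<comment> \<open>With \<open>f' = - f^3 / c\<close>, the left side \<open>f' / f\<close> of the
    flow equation is \<open>- f^2 / c\<close>, minus the reciprocal of the scaled curvature
    \<open>c / f^2\<close>.\<close>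
  have d: "(f has_real_derivative - (f t ^ 3 / c)) (at t within J)" if "t \<in> J" for t
  proof -
    let ?g = "\<lambda>t. 1 / sqrt (2 * t / c + 1)"
    have g: "(?g has_vector_derivative - (f t ^ 3 / c)) (at t within J)"
      unfolding has_real_derivative_iff_has_vector_derivative[symmetric]
      using pos[OF that] \<open>c \<noteq> 0\<close>
      by (auto intro!: derivative_eq_intros simp: f[OF that] field_simps power3_eq_cube)
    show ?thesis
      unfolding has_real_derivative_iff_has_vector_derivative
      by (rule has_vector_derivative_transform[OF that f g])
  qed
  have "curvature I (\<lambda>u. f t *\<^sub>R X u) s = c / f t ^ 2" if "s \<in> I" "t \<in> J" for s t
    using homothety(2)[OF sc al fpos] k that by simp
  moreover have "mink (vector_derivative (\<lambda>t. f t *\<^sub>R X s) (at t within J))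
      (associated I (\<lambda>u. f t *\<^sub>R X u) s) = - 1 / (c / f t ^ 2)" if "s \<in> I" "t \<in> J" for s t
    using homothetic_ICF_equation[OF assms(1) that(2,1) fpos[OF that(2)] d[OF that(2)]]
      fpos[OF that(2)] by (simp add: power2_eq_square power3_eq_cube)
  moreover have "c / f t ^ 2 \<noteq> 0" if "t \<in> J" for t
    using fpos[OF that] \<open>c \<noteq> 0\<close> by simp
  moreover have "f 0 = 1"
    using f[OF assms(2)] by simp
  ultimately show ?thesis
    using assms(1,2) smooth spacelike_curve_homothety[OF sc al fpos] unfolding ICF_solution_def
    by auto
qed

lemma homothetic_ICF_solutionD:
  assumes ICF: "ICF_solution I J (\<lambda>s t. f t *\<^sub>R X s) X"
    and pos: "\<And>t. t \<in> J \<Longrightarrow> f t > 0" and "f 0 = 1"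
    and k0: "\<And>s. s \<in> I \<Longrightarrow> arc_curvature I X s \<noteq> 0"
  shows "\<exists>c. c \<noteq> 0 \<and> (\<forall>s\<in>I. arc_curvature I X s = c) \<and>
     (\<forall>t\<in>J. 2 * t / c + 1 > 0 \<and> f t = 1 / sqrt (2 * t / c + 1))"
proof -
  have J: "nontrivial_interval J" and "0 \<in> J"
    using ICF by (auto simp: ICF_solution_def)
  obtain s0 where s0: "s0 \<in> I"
    using interval[OF sc al] by (auto simp: nontrivial_interval_def)
  have "X s0 $ 1 > 0"
    using frame(1)[OF sc al s0] by (simp add: future_cone_def)
  \<comment> \<open>Differentiability of \<open>f\<close> is not assumed. It is recovered from the
    first coordinate of \<open>f(t) X(s0)\<close>, as that of \<open>X(s0)\<close> is positive on
    the future cone.\<close>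
  have "\<exists>f'. (f has_real_derivative f') (at t within J)" if "t \<in> J" for t
  proof -
    obtain v where "((\<lambda>t. f t *\<^sub>R X s0) has_vector_derivative v) (at t within J)"
      using ICF_solution_time_derivative[OF ICF s0 \<open>t \<in> J\<close>] .
    from bounded_linear.has_vector_derivative[OF bounded_linear_vec_nth[of 1] this]
    have "((\<lambda>t. f t * X s0 $ 1) has_real_derivative v $ 1) (at t within J)"
      by (simp add: has_real_derivative_iff_has_vector_derivative)
    from DERIV_cdivide[OF this, of "X s0 $ 1"] show ?thesis
      using \<open>X s0 $ 1 > 0\<close> by auto
  qed
  then obtain f' where f': "\<And>t. t \<in> J \<Longrightarrow> (f has_real_derivative f' t) (at t within J)"
    by metis
  have eq: "f' t * arc_curvature I X s = - (f t ^ 3)" if "s \<in> I" "t \<in> J" for s t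
  proof -
    have "f' t / f t = - 1 / (arc_curvature I X s / f t ^ 2)"
      using ICF that homothetic_ICF_equation[OF J that(2,1) pos f'] homothety(2)[OF sc al pos that(1)]
      by (simp add: ICF_solution_def)
    then show ?thesis
      using pos[OF that(2)] k0[OF that(1)] by (simp add: field_simps power2_eq_square power3_eq_cube)
  qed
  define c where "c = arc_curvature I X s0"
  have "c \<noteq> 0"
    using k0[OF s0] by (simp add: c_def)
  \<comment> \<open>At time 0 the equation reads \<open>f'(0) k(s) = -1\<close> for every
    \<open>s\<close>, so \<open>f'(0)\<close> is nonzero and cancels.\<close>
  have k: "arc_curvature I X s = c" if "s \<in> I" for s
  proof -
    have "f' 0 * arc_curvature I X s = f' 0 * c" "f' 0 \<noteq> 0"
      using eq[OF that \<open>0 \<in> J\<close>] eq[OF s0 \<open>0 \<in> J\<close>] \<open>f 0 = 1\<close> by (auto simp: c_def)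
    then show ?thesis by simp
  qed
  \<comment> \<open>A first integral: \<open>(1 / f^2)' = - 2 f' / f^3 = 2 / c\<close>. Its value at
    0 is 1.\<close>
  have "((\<lambda>t. 1 / f t ^ 2 - 2 * t / c) has_real_derivative 0) (at t within J)" if "t \<in> J" for t
  proof -
    have "f' t = - (f t ^ 3 / c)"
      using eq[OF s0 that] \<open>c \<noteq> 0\<close> by (simp add: c_def field_simps)
    then show ?thesis
      using pos[OF that] \<open>c \<noteq> 0\<close>
      by (auto intro!: derivative_eq_intros f'[OF that]
          simp: field_simps power2_eq_square power3_eq_cube)
  qed
  then obtain b where b: "\<And>t. t \<in> J \<Longrightarrow> 1 / f t ^ 2 - 2 * t / c = b"
    using has_field_derivative_zero_constant[of J "\<lambda>t. 1 / f t ^ 2 - 2 * t / c"] J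
    by (auto simp: nontrivial_interval_def is_interval_convex)
  have "b = 1"
    using b[OF \<open>0 \<in> J\<close>] \<open>f 0 = 1\<close> by simp
  have "2 * t / c + 1 > 0 \<and> f t = 1 / sqrt (2 * t / c + 1)" if "t \<in> J" for t
  proof -
    have e: "2 * t / c + 1 = 1 / f t ^ 2"
      using b[OF that] \<open>b = 1\<close> by simp
    show ?thesis
      unfolding e using pos[OF that] by (simp add: real_sqrt_divide)
  qed
  with k \<open>c \<noteq> 0\<close> show ?thesis by blast
qed

section \<open>Maximality of the time interval\<close>

text \<open>On \<open>J\<close> the product of \<open>sqrt (2 t / c + 1)\<close> and
  \<open>G s t\<close> is the nonzero vector \<open>X s\<close>. Near \<open>- c / 2\<close> the
  root tends to 0 while \<open>G s\<close> converges by continuity, so the product would tend to 0.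
  \<open>G\<close> need not be homothetic off \<open>J\<close>.\<close>

lemma homothetic_ICF_not_extendable:
  assumes G: "ICF_solution I J' G X" and "J \<subseteq> J'" and end_in: "- c / 2 \<in> J'"
    and eq: "\<And>s t. s \<in> I \<Longrightarrow> t \<in> J \<Longrightarrow> G s t = (1 / sqrt (2 * t / c + 1)) *\<^sub>R X s"
    and pos: "\<And>t. t \<in> J \<Longrightarrow> 2 * t / c + 1 > 0" and "c \<noteq> 0"
    and limpt: "at (- c / 2) within J \<noteq> bot"
  shows False
proof -
  obtain s where s: "s \<in> I"
    using interval[OF sc al] by (auto simp: nontrivial_interval_def)
  have "X s \<noteq> 0"
    using frame(1)[OF sc al s] by (auto simp: future_cone_def light_cone_def)
  obtain v where "(G s has_vector_derivative v) (at (- c / 2) within J')"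
    using ICF_solution_time_derivative[OF G s end_in] .
  then have "(G s \<longlongrightarrow> G s (- c / 2)) (at (- c / 2) within J')"
    using has_vector_derivative_continuous continuous_within by blast
  then have G: "(G s \<longlongrightarrow> G s (- c / 2)) (at (- c / 2) within J)"
    using \<open>J \<subseteq> J'\<close> tendsto_within_subset by blast
  have "((\<lambda>t. sqrt (2 * t / c + 1)) \<longlongrightarrow> sqrt (2 * (- c / 2) / c + 1)) (at (- c / 2) within J)"
    by (intro tendsto_intros) (use \<open>c \<noteq> 0\<close> in auto)
  then have "((\<lambda>t. sqrt (2 * t / c + 1)) \<longlongrightarrow> 0) (at (- c / 2) within J)"
    using \<open>c \<noteq> 0\<close> by simp
  from tendsto_scaleR[OF this G]
  have "((\<lambda>t. sqrt (2 * t / c + 1) *\<^sub>R G s t) \<longlongrightarrow> 0) (at (- c / 2) within J)"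
    by simp
  moreover have "sqrt (2 * t / c + 1) *\<^sub>R G s t = X s" if "t \<in> J" for t
    using pos[OF that] by (simp add: eq[OF s that])
  then have "\<forall>\<^sub>F t in at (- c / 2) within J. sqrt (2 * t / c + 1) *\<^sub>R G s t = X s"
    by (simp add: eventually_at_filter)
  ultimately have "((\<lambda>t. X s) \<longlongrightarrow> 0) (at (- c / 2) within J)"
    by (rule Lim_transform_eventually)
  then show False
    using limpt \<open>X s \<noteq> 0\<close> by (simp add: tendsto_const_iff)
qed

text \<open>The explicit formula solves the flow on the whole half-line, so a maximal
  \<open>J\<close> must fill it. Conversely, any larger interval contains the endpoint
  \<open>- c / 2\<close>, which \<open>homothetic_ICF_not_extendable\<close> excludes.\<close>

lemma maximal_homothetic_ICF_solution_iff:
  assumes ICF: "ICF_solution I J (\<lambda>s t. f t *\<^sub>R X s) X"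
    and k: "\<And>s. s \<in> I \<Longrightarrow> arc_curvature I X s = c" and "c \<noteq> 0"
    and f: "\<And>t. t \<in> J \<Longrightarrow> 2 * t / c + 1 > 0 \<and> f t = 1 / sqrt (2 * t / c + 1)"
  shows "maximal_ICF_solution I J (\<lambda>s t. f t *\<^sub>R X s) X \<longleftrightarrow> J = {t. 2 * t / c + 1 > 0}"
proof
  let ?M = "{t. 2 * t / c + 1 > 0}" and ?G = "\<lambda>s t. (1 / sqrt (2 * t / c + 1)) *\<^sub>R X s"
  have M: "?M = (if c > 0 then {- c / 2<..} else {..<- c / 2})"
    using \<open>c \<noteq> 0\<close> by (auto simp: field_simps)
  have J: "nontrivial_interval J" "0 \<in> J" "J \<subseteq> ?M"
    using ICF f by (auto simp: ICF_solution_def)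
  {
    assume max: "maximal_ICF_solution I J (\<lambda>s t. f t *\<^sub>R X s) X"
    have "is_interval ?M"
      unfolding M by (simp add: is_interval_oi is_interval_io)
    then have "nontrivial_interval ?M"
      using J(1,3) unfolding nontrivial_interval_def by blast
    then have "ICF_solution I ?M ?G X"
      by (intro homothetic_ICF_solutionI[where c = c]) (use k \<open>c \<noteq> 0\<close> in auto)
    with max show "J = ?M"
      using J f unfolding maximal_ICF_solution_def by (metis (no_types, lifting))
  next
    assume JM: "J = ?M"
    have "J' = J" if J': "ICF_solution I J' G X" "J \<subseteq> J'" "\<forall>s\<in>I. \<forall>t\<in>J. G s t = f t *\<^sub>R X s" for J' G
    proof (rule ccontr)
      assume "J' \<noteq> J"
      then obtain x where x: "x \<in> J'" "x \<notin> ?M"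
        using JM J'(2) by auto
      have "is_interval J'"
        using J'(1) by (simp add: ICF_solution_def nontrivial_interval_def)
      \<comment> \<open>\<open>J'\<close> contains 0, inside the half-line, and \<open>x\<close>,
        outside it, hence also the endpoint between them.\<close>
      have "- c / 2 \<in> J'"
        using mem_is_interval_1_I[OF \<open>is_interval J'\<close>, of 0 x "- c / 2"]
          mem_is_interval_1_I[OF \<open>is_interval J'\<close>, of x 0 "- c / 2"] x J'(2) J(2) \<open>c \<noteq> 0\<close>
        unfolding M by (cases "c > 0") auto
      moreover have "at (- c / 2) within J \<noteq> bot"
        unfolding JM M by simp
      ultimately show False
        using homothetic_ICF_not_extendable[OF J'(1,2), of c] J'(3) f \<open>c \<noteq> 0\<close> by auto
    qed
    then show "maximal_ICF_solution I J (\<lambda>s t. f t *\<^sub>R X s) X"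
      using ICF unfolding maximal_ICF_solution_def by auto
  }
qed

end

section \<open>The equivalence and the two sign cases\<close>

theorem theorem1p3:
  fixes I J :: "real set" and X :: "real \<Rightarrow> real^3" and k f :: "real \<Rightarrow> real"
    and F :: "real \<Rightarrow> real \<Rightarrow> real^3"
  assumes "spacelike_curve I X" and "arc_length_param I X"
    and "\<forall>s\<in>I. k s = arc_curvature I X s" and "\<forall>s\<in>I. k s \<noteq> 0"
    and "nontrivial_interval J" and "0 \<in> J"
    and "\<forall>t\<in>J. f t > 0" and "f 0 = 1"
    and "\<forall>s t. F s t = f t *\<^sub>R X s"
  shows "(ICF_solution I J F X \<longleftrightarrow>
           (\<exists>c. (\<forall>s\<in>I. k s = c) \<and> (\<forall>t\<in>J. f t = 1 / sqrt (2 * t / c + 1)) \<and>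
                (\<forall>s\<in>I. \<forall>t\<in>J. curvature I (\<lambda>u. F u t) s = 2 * t + c))) \<and>
         (\<forall>c. ICF_solution I J F X \<and> (\<forall>s\<in>I. k s = c) \<longrightarrow>
            (c < 0 \<longrightarrow>
               ellipse_with_curvature I X c \<and>
               (maximal_ICF_solution I J F X \<longleftrightarrow> J = {..<- c / 2}) \<and>
               (maximal_ICF_solution I J F X \<longrightarrow>
                  ancient_solution I J F X \<and> evolves_from_origin I F)) \<and>
            (c > 0 \<longrightarrow>
               hyperbola_with_curvature I X c \<and>
               (maximal_ICF_solution I J F X \<longleftrightarrow> J = {- c / 2<..})))"
proof -
  have F: "F = (\<lambda>s t. f t *\<^sub>R X s)"
    using assms(9) by auto
  obtain s0 where s0: "s0 \<in> I"
    using interval[OF assms(1,2)] by (auto simp: nontrivial_interval_def)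
  \<comment> \<open>The constant supplied by \<open>homothetic_ICF_solutionD\<close> is the given
    \<open>c\<close>, because both are the value of \<open>k\<close> at \<open>s0\<close>.\<close>
  have data: "c \<noteq> 0 \<and> (\<forall>t\<in>J. 2 * t / c + 1 > 0 \<and> f t = 1 / sqrt (2 * t / c + 1))"
    if "ICF_solution I J F X" "\<forall>s\<in>I. k s = c" for c
    using homothetic_ICF_solutionD[OF assms(1,2) that(1)[unfolded F]] that(2) assms(3,4,7,8) s0
    by (metis (no_types, lifting))
  have const: "\<exists>c. \<forall>s\<in>I. k s = c" if "ICF_solution I J F X"
    using homothetic_ICF_solutionD[OF assms(1,2) that(1)[unfolded F]] assms(3,4,7,8) by auto
  have curv: "curvature I (\<lambda>u. F u t) s = 2 * t + c"
    if "\<forall>s\<in>I. k s = c" "c \<noteq> 0" "2 * t / c + 1 > 0" "f t = 1 / sqrt (2 * t / c + 1)"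
      "s \<in> I" for c s t
  proof -
    \<comment> \<open>Scaling gives \<open>c / f^2\<close>, and \<open>1 / f^2\<close> is the
      radicand.\<close>
    have "curvature I (\<lambda>u. F u t) s = c * (2 * t / c + 1)"
      using that homothety(2)[OF assms(1,2) _ that(5), of "f t"] assms(3)
      by (simp add: F power_divide)
    then show ?thesis
      using that(2) by (simp add: distrib_left)
  qed
  have "ICF_solution I J F X"
    if "\<forall>s\<in>I. k s = c" and f: "\<forall>t\<in>J. f t = 1 / sqrt (2 * t / c + 1)" for c
  proof -
    have "c \<noteq> 0"
      using that(1) assms(4) s0 by auto
    \<comment> \<open>In HOL \<open>sqrt\<close> is negative on negative numbers and
      \<open>1 / 0 = 0\<close>, so \<open>f t > 0\<close> leaves only a positive radicand.\<close>
    moreover have "2 * t / c + 1 > 0" if "t \<in> J" for t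
      using assms(7) f that by (metis real_sqrt_gt_0_iff zero_less_divide_1_iff)
    ultimately show ?thesis
      unfolding F using assms that by (intro homothetic_ICF_solutionI[where c = c]) auto
  qed
  moreover have "\<exists>c. (\<forall>s\<in>I. k s = c) \<and> (\<forall>t\<in>J. f t = 1 / sqrt (2 * t / c + 1)) \<and>
      (\<forall>s\<in>I. \<forall>t\<in>J. curvature I (\<lambda>u. F u t) s = 2 * t + c)" if sol: "ICF_solution I J F X"
  proof -
    obtain c where c: "\<forall>s\<in>I. k s = c"
      using const[OF sol] by auto
    show ?thesis
      using data[OF sol c] curv[OF c] c by (intro exI[of _ c]) auto
  qed
  moreover {
    fix c assume sol: "ICF_solution I J F X" and c: "\<forall>s\<in>I. k s = c"
    have f: "c \<noteq> 0" "\<And>t. t \<in> J \<Longrightarrow> 2 * t / c + 1 > 0 \<and> f t = 1 / sqrt (2 * t / c + 1)"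
      using data[OF sol c] by auto
    \<comment> \<open>The general curvature of \<open>X\<close> is read off at time 0, where
      \<open>f 0 = 1\<close> makes the family equal to \<open>X\<close>.\<close>
    have conic: "curvature I X s = c" if "s \<in> I" for s
      using curv[OF c f(1) _ _ that, of 0] assms(8) by (simp add: F)
    have "arc_curvature I X s = c" if "s \<in> I" for s
      using assms(3) c that by auto
    from maximal_homothetic_ICF_solution_iff[OF assms(1,2) sol[unfolded F] this f]
    have max: "maximal_ICF_solution I J F X \<longleftrightarrow> J = {t. 2 * t / c + 1 > 0}"
      by (simp add: F)
    have "ellipse_with_curvature I X c \<and> (maximal_ICF_solution I J F X \<longleftrightarrow> J = {..<- c / 2}) \<and>
      (maximal_ICF_solution I J F X \<longrightarrow> ancient_solution I J F X \<and> evolves_from_origin I F)"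
      if "c < 0"
    proof -
      have M: "{t. 2 * t / c + 1 > 0} = {..<- c / 2}"
        using that by (auto simp: field_simps)
      have "evolves_from_origin I F" if J: "J = {..<- c / 2}"
      proof -
        \<comment> \<open>After reflecting \<open>t\<close> to \<open>- t\<close>, the radicand is
          affine with positive slope because \<open>c < 0\<close>.\<close>
        have "filterlim (\<lambda>t. 1 + (2 / - c) * t) at_top at_top"
          by (intro filterlim_tendsto_add_at_top filterlim_tendsto_pos_mult_at_top tendsto_const
              filterlim_ident) (use \<open>c < 0\<close> in auto)
        then have "filterlim (\<lambda>t. 2 * t / c + 1) at_top at_bot"
          by (simp add: filterlim_at_bot_mirror add.commute)
        then have "((\<lambda>t. 1 / sqrt (2 * t / c + 1)) \<longlongrightarrow> 0) at_bot"
          by (intro tendsto_divide_0[OF tendsto_const] filterlim_at_top_imp_at_infinity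
              filterlim_compose[OF sqrt_at_top])
        \<comment> \<open>The formula for \<open>f\<close> is known only on \<open>J\<close>, which
          contains every time below \<open>- c / 2\<close>.\<close>
        moreover have "\<forall>\<^sub>F t in at_bot. 1 / sqrt (2 * t / c + 1) = f t"
          using eventually_gt_at_bot[of "- c / 2"] by eventually_elim (use f J in auto)
        ultimately have "(f \<longlongrightarrow> 0) at_bot"
          by (rule Lim_transform_eventually)
        then show ?thesis
          unfolding evolves_from_origin_def F by (auto intro: tendsto_eq_intros)
      qed
      then show ?thesis
        using conic assms(1) that sol max
        unfolding M ellipse_with_curvature_def ancient_solution_def by auto
    qed
    moreover have "hyperbola_with_curvature I X c \<and>
      (maximal_ICF_solution I J F X \<longleftrightarrow> J = {- c / 2<..})" if "c > 0"
    proof -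
      have "{t. 2 * t / c + 1 > 0} = {- c / 2<..}"
        using that by (auto simp: field_simps)
      then show ?thesis
        using conic assms(1) that max unfolding hyperbola_with_curvature_def by auto
    qed
    ultimately have "(c < 0 \<longrightarrow>
               ellipse_with_curvature I X c \<and>
               (maximal_ICF_solution I J F X \<longleftrightarrow> J = {..<- c / 2}) \<and>
               (maximal_ICF_solution I J F X \<longrightarrow>
                  ancient_solution I J F X \<and> evolves_from_origin I F)) \<and>
            (c > 0 \<longrightarrow>
               hyperbola_with_curvature I X c \<and>
               (maximal_ICF_solution I J F X \<longleftrightarrow> J = {- c / 2<..}))"
      by blast
  }
  ultimately show ?thesis by blast
qed

end
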